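(* Let $\Omega\subset\mathbb{R}^N$ be an open set, $N\geq 1$, $p>1$, $\alpha>0$, $A\in C^1(\Omega)$ and $X\in C^1(\Omega,\mathbb{R}^N)$. Then for any $u\in C_0^1(\Omega)$, $$\alpha^{p}\int_{\Omega}A|\nabla u|^{p}\,dx+\frac{p-1}{\alpha^{\frac{p}{p-1}}}\int_{\Omega}A|X|^{p}|u|^{p}\,dx=-\int_{\Omega}\operatorname{div}\left(A|X|^{p-2}X\right)|u|^{p}\,dx+\int_{\Omega}A\,\mathcal{R}_{p}\left(\frac{1}{\alpha^{\frac{1}{p-1}}}uX,\ \alpha\nabla u\right)dx$$ and $$\alpha^{p}\int_{\Omega}A\left|\frac{X}{|X|}\cdot\nabla u\right|^{p}dx+\frac{p-1}{\alpha^{\frac{p}{p-1}}}\int_{\Omega}A|X|^{p}|u|^{p}\,dx=-\int_{\Omega}\operatorname{div}\left(A|X|^{p-2}X\right)|u|^{p}\,dx+\int_{\Omega}A\,\mathcal{R}_{p}\left(\frac{1}{\alpha^{\frac{1}{p-1}}}u|X|,\ \alpha\frac{X}{|X|}\cdot\nabla u\right)dx.$$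
   Context: Functions are real valued and $C_0^1(\Omega)$ denotes $C^1$ functions with compact support in $\Omega$. For $n\ge 1$ and $a,b\in\mathbb{R}^n$, $$\mathcal{R}_p(a,b)=|b|^p+(p-1)|a|^p-p|a|^{p-2}a\cdot b,$$ with $|a|^{p-2}a:=0$ when $a=0$ (in the first identity $n=N$; in the second identity the arguments are scalars, $n=1$). Conventions: $|X|^{p-2}X:=0$ and $\frac{X}{|X|}:=0$ at points where $X=0$. If $A|X|^{p-2}X$ is not $C^1$ (possible when $1<p<2$ and $X$ has zeros), its divergence is understood in the distributional sense, i.e. $-\int_\Omega \operatorname{div}(A|X|^{p-2}X)|u|^p\,dx$ means $\int_\Omega A|X|^{p-2}X\cdot\nabla(|u|^p)\,dx$. *)

theory Defs
  imports "HOL-Analysis.Analysis"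
begin

definition C1_on :: "'a::euclidean_space set \<Rightarrow> ('a \<Rightarrow> 'b::euclidean_space) \<Rightarrow> bool" where
  "C1_on \<Omega> f \<longleftrightarrow>
     (\<exists>f' :: 'a \<Rightarrow> 'a \<Rightarrow>\<^sub>L 'b.
        (\<forall>x\<in>\<Omega>. (f has_derivative blinfun_apply (f' x)) (at x)) \<and> continuous_on \<Omega> f')"

(* The closure is taken in the whole space; its inclusion in \<Omega> makes it the closure relative
   to \<Omega>. Values of u outside \<Omega> play no role. *)
definition C1_compact_support :: "'a::euclidean_space set \<Rightarrow> ('a \<Rightarrow> real) \<Rightarrow> bool" where
  "C1_compact_support \<Omega> u \<longleftrightarrow>
     C1_on \<Omega> u \<and> compact (closure (support_on \<Omega> u)) \<and> closure (support_on \<Omega> u) \<subseteq> \<Omega>"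

definition gradient :: "('a::euclidean_space \<Rightarrow> real) \<Rightarrow> 'a \<Rightarrow> 'a" where
  "gradient u x = (THE D. GDERIV u x :> D)"

definition divergence :: "(real ^ 'n \<Rightarrow> real ^ 'n) \<Rightarrow> real ^ 'n \<Rightarrow> real" where
  "divergence F x = (\<Sum>i\<in>UNIV. frechet_derivative F (at x) (axis i 1) $ i)"

(* The integral over \<Omega> of (div F) \<phi>: classical if F is C^1 on \<Omega>, and otherwise the
   value of the distributional divergence of F on the test function \<phi>. *)
definition div_integral ::
    "(real ^ 'n) set \<Rightarrow> (real ^ 'n \<Rightarrow> real ^ 'n) \<Rightarrow> (real ^ 'n \<Rightarrow> real) \<Rightarrow> real" where
  "div_integral \<Omega> F \<phi> =
     (if C1_on \<Omega> F then (LINT x:\<Omega>|lebesgue. divergence F x * \<phi> x)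
      else - (LINT x:\<Omega>|lebesgue. F x \<bullet> gradient \<phi> x))"

(* Since 0 powr s = 0 for every s, the vector |a|^(p-2) a is 0 at a = 0.
   For scalars, norm is the absolute value and the inner product is multiplication. *)
definition R_p :: "real \<Rightarrow> 'a::euclidean_space \<Rightarrow> 'a \<Rightarrow> real" where
  "R_p p a b = norm b powr p + (p - 1) * norm a powr p
                - p * ((norm a powr (p - 2) *\<^sub>R a) \<bullet> b)"

(* X/|X|; it is 0 where X = 0, because inverse 0 = 0. *)
definition unit_field :: "('a::euclidean_space \<Rightarrow> 'a) \<Rightarrow> 'a \<Rightarrow> 'a" where
  "unit_field X x = X x /\<^sub>R norm (X x)"

end

theory Submission
  imports Defs
begin

text \<open>The remainder \<open>R\<^sub>p\<close> is by definition what makes both identities hold pointwise. Put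
  \<open>F = A |X|\<^bsup>p - 2\<^esup> X\<close> and \<open>\<phi> = |u|\<^sup>p\<close>. Expanding \<open>A R\<^sub>p\<close> at the given arguments
  (\<open>R_p_scaled\<close>) yields the two densities on the left-hand side minus a mixed term
  \<open>p A |u|\<^bsup>p - 2\<^esup> u |X|\<^bsup>p - 2\<^esup> X \<bullet> \<nabla>u\<close>. By the chain rule for \<open>|t|\<^sup>p\<close>
  (\<open>C1_on_abs_powr\<close>) the mixed term is \<open>F \<bullet> \<nabla>\<phi>\<close>. It is the same for the second
  identity, because \<open>|X| (X / |X| \<bullet> \<nabla>u) = X \<bullet> \<nabla>u\<close>.

  All densities are bounded, measurable and vanish outside the compact support of \<open>u\<close>, hence the
  integrals may be split, and it remains to see that \<open>F \<bullet> \<nabla>\<phi>\<close> integrates to minus the integral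
  of \<open>div F \<phi>\<close>. If \<open>F\<close> is not \<open>C\<^sup>1\<close>, this is the definition of the distributional
  divergence. Otherwise it is integration by parts (\<open>integral_divergence_by_parts\<close>), which rests on
  the fact that a directional derivative of a compactly supported \<open>C\<^sup>1\<close> function has integral zero
  (\<open>integral_directional_derivative_eq_0\<close>), a consequence of translation invariance.\<close>

section \<open>Integrals of derivatives of compactly supported functions\<close>

text \<open>The integral is the limit, as \<open>t\<close> tends to \<open>0\<close>, of the integrals of the difference quotients
  \<open>(f (x + t v) - f x) / t\<close>, and each of these vanishes by translation invariance. Dominated
  convergence applies because \<open>f\<close> is Lipschitz with constant \<open>B\<close> and all quotients with \<open>t \<le> 1\<close>
  live in a fixed ball. This route avoids Fubini's theorem and any choice of coordinates.\<close>

lemma integral_directional_derivative_eq_0: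
  fixes f :: "'a::euclidean_space \<Rightarrow> real"
  assumes K: "compact K" "\<And>x. x \<notin> K \<Longrightarrow> f x = 0"
    and deriv: "\<And>x. (f has_derivative f' x) (at x)"
    and bound: "\<And>x h. \<bar>f' x h\<bar> \<le> B * norm h"
  shows "(\<lambda>x. f' x v) \<in> borel_measurable borel" and "(LINT x|lborel. f' x v) = 0"
proof -
  define q where "q n x = (f (x + v /\<^sub>R real (Suc n)) - f x) * real (Suc n)" for n x
  have contf: "continuous_on UNIV f"
    by (meson continuous_at_imp_continuous_on deriv has_derivative_continuous)
  have [measurable]: "f \<in> borel_measurable borel"
    using contf by (rule borel_measurable_continuous_onI)
  have meas_q: "q n \<in> borel_measurable borel" for n
    unfolding q_def by measurable
  have lim: "(\<lambda>n. q n x) \<longlonglongrightarrow> f' x v" for x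
  proof -
    have "((\<lambda>t. f (x + t *\<^sub>R v)) has_derivative (\<lambda>t. f' x (t *\<^sub>R v))) (at 0)"
      by (rule has_derivative_compose[where f="\<lambda>t. x + t *\<^sub>R v" and g=f and x=0, simplified])
        (auto intro!: derivative_eq_intros simp: deriv)
    then have "((\<lambda>t. f (x + t *\<^sub>R v)) has_real_derivative f' x v) (at 0)"
      unfolding has_field_derivative_def
      by (rule has_derivative_eq_rhs)
        (simp add: fun_eq_iff linear_cmul[OF has_derivative_linear[OF deriv]])
    then have "((\<lambda>h. (f (x + h *\<^sub>R v) - f x) / h) \<longlongrightarrow> f' x v) (at 0)"
      by (simp add: DERIV_def)
    then have "((\<lambda>n. (f (x + inverse (real (Suc n)) *\<^sub>R v) - f x) / inverse (real (Suc n)))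
        \<longlonglongrightarrow> f' x v)"
      by (rule filterlim_compose)
        (use LIMSEQ_inverse_real_of_nat in \<open>auto simp: filterlim_at\<close>)
    then show ?thesis by (simp add: q_def divide_inverse)
  qed
  show "(\<lambda>x. f' x v) \<in> borel_measurable borel"
    using lim meas_q by (rule borel_measurable_LIMSEQ_real)
  have int_f: "integrable lborel f"
  proof -
    have "(\<lambda>x. indicator K x *\<^sub>R f x) = f"
      using K(2) by (auto simp: indicator_def fun_eq_iff)
    with borel_integrable_compact[OF K(1) continuous_on_subset[OF contf]] show ?thesis by simp
  qed
  \<comment> \<open>By translation invariance every difference quotient has integral zero.\<close>
  have shift: "integrable lborel (\<lambda>x. f (x + c))" "(LINT x|lborel. f (x + c)) = (LINT x|lborel. f x)" for c
  proof -
    have "integrable (distr lborel borel ((+) c)) f" using int_f by (simp add: lborel_distr_plus)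
    then show "integrable lborel (\<lambda>x. f (x + c))"
      by (subst (asm) integrable_distr_eq) (auto simp: add.commute)
    have "(LINT x|distr lborel borel ((+) c). f x) = (LINT x|lborel. f (c + x))"
      by (rule integral_distr) auto
    then show "(LINT x|lborel. f (x + c)) = (LINT x|lborel. f x)"
      by (simp add: lborel_distr_plus add.commute)
  qed
  have int_q: "(LINT x|lborel. q n x) = 0" for n
    unfolding q_def using shift int_f by simp
  obtain r where r: "\<And>x. x \<in> K \<Longrightarrow> norm x \<le> r"
    using compact_imp_bounded[OF K(1)] by (auto simp: bounded_iff)
  have "(\<lambda>n. LINT x|lborel. q n x) \<longlonglongrightarrow> (LINT x|lborel. f' x v)"
  proof (rule integral_dominated_convergence)
    \<comment> \<open>\<open>K\<close> lies in the ball of radius \<open>r\<close>, and the shifts by \<open>v / (n + 1)\<close> have length at most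
      \<open>norm v\<close>, so every quotient vanishes outside the ball of radius \<open>r + norm v\<close>.\<close>
    show "integrable lborel (\<lambda>x. indicator (cball 0 (r + norm v)) x *\<^sub>R (B * norm v))"
      by (intro borel_integrable_compact) auto
    show "AE x in lborel. norm (q n x) \<le> indicator (cball 0 (r + norm v)) x *\<^sub>R (B * norm v)" for n
    proof (rule AE_I2)
      fix x :: 'a
      let ?h = "v /\<^sub>R real (Suc n)"
      have hv: "norm ?h \<le> norm v" by (simp add: field_simps mult_left_le)
      show "norm (q n x) \<le> indicator (cball 0 (r + norm v)) x *\<^sub>R (B * norm v)"
      proof (cases "x \<in> cball 0 (r + norm v)")
        case True
        have "norm (f (x + ?h) - f x) \<le> B * norm (x + ?h - x)"
          by (rule differentiable_bound[of UNIV f f'])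
            (auto simp: deriv intro!: onorm_le bound)
        then have "norm (f (x + ?h) - f x) * real (Suc n) \<le> B * norm ?h * real (Suc n)"
          by (intro mult_right_mono) auto
        also have "\<dots> = B * norm v" by simp
        finally show ?thesis using True by (simp add: q_def abs_mult)
      next
        case False
        then have "r + norm v < norm x" by simp
        moreover have "norm x \<le> norm (x + ?h) + norm ?h"
          using norm_triangle_ineq4[of "x + ?h" ?h] by simp
        ultimately have "r < norm (x + ?h)" "r < norm x"
          using hv norm_ge_zero[of v] by linarith+
        then have "x + ?h \<notin> K" "x \<notin> K" using r by (meson not_less)+
        then show ?thesis using False K(2) by (simp add: q_def)
      qed
    qed
    show "(\<lambda>x. f' x v) \<in> borel_measurable lborel"
      using \<open>(\<lambda>x. f' x v) \<in> borel_measurable borel\<close> by simp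
    show "q n \<in> borel_measurable lborel" for n using meas_q by simp
    show "AE x in lborel. (\<lambda>n. q n x) \<longlonglongrightarrow> f' x v" using lim by simp
  qed
  then show "(LINT x|lborel. f' x v) = 0"
    using int_q by (simp add: LIMSEQ_const_iff)
qed

lemma C1_on_continuous_on: "C1_on S f \<Longrightarrow> continuous_on S f"
  unfolding C1_on_def by (meson continuous_at_imp_continuous_on has_derivative_continuous)

lemma has_derivative_0_outside:
  assumes "open S" "closed K" "\<And>x. x \<in> S - K \<Longrightarrow> f x = 0" "x \<in> S - K"
  shows "(f has_derivative (\<lambda>h. 0)) (at x)"
  by (rule has_derivative_transform_within_open[of "\<lambda>_. 0", OF _ open_Diff[OF assms(1,2)] assms(4)])
    (auto simp: assms(3))

text \<open>Extension of \<open>f\<close> by zero reduces this to the whole space: the extension is differentiable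
  because \<open>S\<close> and the complement of \<open>K\<close> are open and cover the space, and its derivative is bounded
  because it is continuous on the compact set \<open>K\<close> and zero elsewhere.\<close>

lemma set_integral_C1_derivative_eq_0:
  fixes f :: "'a::euclidean_space \<Rightarrow> real" and f' :: "'a \<Rightarrow> 'a \<Rightarrow>\<^sub>L real"
  assumes S: "open S" and K: "compact K" "K \<subseteq> S" "\<And>x. x \<in> S - K \<Longrightarrow> f x = 0"
    and deriv: "\<And>x. x \<in> S \<Longrightarrow> (f has_derivative f' x) (at x)"
    and cont: "continuous_on S f'"
  shows "(LINT x:S|lebesgue. f' x v) = 0"
proof -
  define g where "g x = (if x \<in> S then f x else 0)" for x
  define g' where "g' x = (if x \<in> S then f' x else 0)" for x
  have gK: "g x = 0" if "x \<notin> K" for x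
    using that K(3) by (auto simp: g_def)
  have g_outside: "(g has_derivative (\<lambda>h. 0)) (at x)" if "x \<notin> K" for x
    using has_derivative_0_outside[of UNIV K g x] compact_imp_closed[OF K(1)] gK that by simp
  have deriv_g: "(g has_derivative g' x) (at x)" for x
  proof (cases "x \<in> S")
    case True
    have "(g has_derivative f' x) (at x)"
      by (rule has_derivative_transform_within_open[OF deriv[OF True] S True]) (simp add: g_def)
    then show ?thesis using True by (simp add: g'_def)
  next
    case False
    then have "(g has_derivative (\<lambda>h. 0)) (at x)" using g_outside K(2) by blast
    then show ?thesis using False by (simp add: g'_def zero_blinfun.rep_eq)
  qed
  have "bounded (f' ` K)"
    using compact_continuous_image[OF continuous_on_subset[OF cont K(2)] K(1)]
    by (rule compact_imp_bounded)
  then obtain B where B: "0 < B" "\<And>x. x \<in> K \<Longrightarrow> norm (f' x) \<le> B"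
    by (auto simp: bounded_pos)
  have norm_g': "norm (g' x) \<le> B" for x
  proof (cases "x \<in> K")
    case True then show ?thesis using B(2) K(2) by (auto simp: g'_def)
  next
    case False
    have "blinfun_apply (g' x) = (\<lambda>h. 0)"
      by (rule has_derivative_unique[OF deriv_g g_outside[OF False]])
    then have "g' x = 0" by (intro blinfun_eqI) simp
    then show ?thesis using B(1) by simp
  qed
  have bound: "\<bar>g' x h\<bar> \<le> B * norm h" for x h
    using norm_blinfun[of "g' x" h] mult_right_mono[OF norm_g', of "norm h" x] by simp
  note * = integral_directional_derivative_eq_0[of K g "\<lambda>x. blinfun_apply (g' x)", OF K(1) gK deriv_g bound, of v]
  have "(\<lambda>x. indicator S x *\<^sub>R f' x v) = (\<lambda>x. g' x v)"
    by (auto simp: g'_def fun_eq_iff zero_blinfun.rep_eq)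
  then show ?thesis
    unfolding set_lebesgue_integral_def using * by (simp add: integral_completion)
qed

section \<open>Gradients and integration by parts\<close>

lemma gradient_eqI:
  assumes "(f has_derivative (\<lambda>h. h \<bullet> D)) (at x)"
  shows "gradient f x = D"
  unfolding gradient_def gderiv_def
proof (rule the_equality[where P="\<lambda>D. (f has_derivative (\<lambda>h. h \<bullet> D)) (at x)", OF assms])
  fix E assume "(f has_derivative (\<lambda>h. h \<bullet> E)) (at x)"
  then have "(\<lambda>h. h \<bullet> E) = (\<lambda>h. h \<bullet> D)" using assms by (rule has_derivative_unique)
  then have "\<And>h. h \<bullet> E = h \<bullet> D" by metis
  then show "E = D" by (metis vector_eq_ldot)
qed

text \<open>The gradient is the Riesz representative of the derivative. Its coordinates are values of the
  derivative at basis vectors, so it inherits continuity.\<close>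

lemma C1_on_gradient:
  fixes f :: "'a::euclidean_space \<Rightarrow> real"
  assumes "C1_on S f"
  shows "\<And>x. x \<in> S \<Longrightarrow> (f has_derivative (\<lambda>h. h \<bullet> gradient f x)) (at x)"
    and "continuous_on S (gradient f)"
proof -
  obtain f' where f': "\<And>x. x \<in> S \<Longrightarrow> (f has_derivative blinfun_apply (f' x)) (at x)" "continuous_on S f'"
    using assms unfolding C1_on_def by blast
  define D where "D x = (\<Sum>b\<in>Basis. f' x b *\<^sub>R b)" for x
  have f'_eq: "blinfun_apply (f' x) = (\<lambda>h. h \<bullet> D x)" for x
  proof
    fix h
    have "f' x h = f' x (\<Sum>b\<in>Basis. (h \<bullet> b) *\<^sub>R b)" by (simp add: euclidean_representation)
    also have "\<dots> = h \<bullet> D x"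
      by (simp add: D_def blinfun.sum_right blinfun.scaleR_right inner_sum_right mult.commute)
    finally show "f' x h = h \<bullet> D x" .
  qed
  have deriv: "(f has_derivative (\<lambda>h. h \<bullet> D x)) (at x)" if "x \<in> S" for x
    using f'(1)[OF that] by (simp add: f'_eq)
  then have grad: "gradient f x = D x" if "x \<in> S" for x
    using that gradient_eqI by blast
  show "(f has_derivative (\<lambda>h. h \<bullet> gradient f x)) (at x)" if "x \<in> S" for x
    using deriv[OF that] grad[OF that] by simp
  have "continuous_on S D"
    unfolding D_def by (intro continuous_intros f'(2))
  then show "continuous_on S (gradient f)"
    using grad by (simp cong: continuous_on_cong)
qed

lemma C1_onI_gradient:
  fixes f :: "'a::euclidean_space \<Rightarrow> real"
  assumes "\<And>x. x \<in> S \<Longrightarrow> (f has_derivative (\<lambda>h. h \<bullet> G x)) (at x)" "continuous_on S G"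
  shows "C1_on S f"
  unfolding C1_on_def
proof (intro exI conjI ballI)
  show "(f has_derivative blinfun_apply (blinfun_inner_left (G x))) (at x)" if "x \<in> S" for x
    using assms(1)[OF that] by (simp add: blinfun_inner_left.rep_eq)
  show "continuous_on S (\<lambda>x. blinfun_inner_left (G x))"
    by (intro continuous_intros assms(2))
qed

lemma gradient_eq_0_outside:
  assumes "open S" "closed K" "\<And>x. x \<in> S - K \<Longrightarrow> f x = 0" "x \<in> S - K"
  shows "gradient f x = 0"
  using has_derivative_0_outside[OF assms] by (simp add: gradient_eqI)

text \<open>Continuity of \<open>f\<close> itself is too much to ask: \<open>X / |X|\<close> jumps at the zeros of \<open>X\<close>. A
  measurable function with a continuous majorant on the compact set is enough.\<close>

lemma set_integrable_bounded_compact_support: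
  fixes f :: "'a::euclidean_space \<Rightarrow> real"
  assumes K: "compact K" "K \<subseteq> S" "\<And>x. x \<in> S - K \<Longrightarrow> f x = 0"
    and meas: "f \<in> borel_measurable (restrict_space borel K)"
    and bound: "\<And>x. x \<in> K \<Longrightarrow> \<bar>f x\<bar> \<le> g x" and cont: "continuous_on K g"
  shows "set_integrable lebesgue S f"
proof -
  have "integrable lborel (\<lambda>x. indicator K x *\<^sub>R f x)"
  proof (rule Bochner_Integration.integrable_bound)
    show "integrable lborel (\<lambda>x. indicator K x *\<^sub>R g x)"
      by (rule borel_integrable_compact[OF K(1) cont])
    show "(\<lambda>x. indicator K x *\<^sub>R f x) \<in> borel_measurable lborel"
      using meas K(1) by (simp add: borel_measurable_restrict_space_iff borel_compact)
    show "AE x in lborel. norm (indicator K x *\<^sub>R f x) \<le> norm (indicator K x *\<^sub>R g x)"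
      using bound by (intro AE_I2) (force simp: indicator_def)
  qed
  then have "integrable lebesgue (\<lambda>x. indicator K x *\<^sub>R f x)"
    by (subst integrable_completion) auto
  also have "(\<lambda>x. indicator K x *\<^sub>R f x) = (\<lambda>x. indicator S x *\<^sub>R f x)"
    using K by (auto simp: fun_eq_iff indicator_def)
  finally show ?thesis by (simp add: set_integrable_def)
qed

lemma set_integrable_continuous_compact_support:
  fixes f :: "'a::euclidean_space \<Rightarrow> real"
  assumes "compact K" "K \<subseteq> S" "\<And>x. x \<in> S - K \<Longrightarrow> f x = 0" "continuous_on K f"
  shows "set_integrable lebesgue S f"
  by (rule set_integrable_bounded_compact_support[OF assms(1-3), where g="\<lambda>x. \<bar>f x\<bar>"])
    (auto intro!: borel_measurable_continuous_on_restrict continuous_intros assms(4))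

text \<open>For each coordinate \<open>i\<close>, the function \<open>\<phi> F\<^sub>i\<close> is \<open>C\<^sup>1\<close> with compact support, so its
  \<open>i\<close>-th partial derivative \<open>\<phi> \<partial>\<^sub>i F\<^sub>i + F\<^sub>i \<partial>\<^sub>i \<phi>\<close> has integral zero. Summation over \<open>i\<close>
  gives the claim.\<close>

lemma integral_divergence_by_parts:
  fixes F :: "real ^ 'n \<Rightarrow> real ^ 'n" and \<phi> :: "real ^ 'n \<Rightarrow> real"
  assumes S: "open S" and K: "compact K" "K \<subseteq> S" "\<And>x. x \<in> S - K \<Longrightarrow> \<phi> x = 0"
    and F: "C1_on S F" and \<phi>: "C1_on S \<phi>"
  shows "(LINT x:S|lebesgue. divergence F x * \<phi> x) = - (LINT x:S|lebesgue. F x \<bullet> gradient \<phi> x)"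
proof -
  obtain F' where F': "\<And>x. x \<in> S \<Longrightarrow> (F has_derivative blinfun_apply (F' x)) (at x)" "continuous_on S F'"
    using F unfolding C1_on_def by blast
  note cont = F'(2) C1_on_continuous_on[OF F] C1_on_continuous_on[OF \<phi>] C1_on_gradient(2)[OF \<phi>]
  note contK = cont[THEN continuous_on_subset, OF K(2)]
  have grad0: "gradient \<phi> x = 0" if "x \<in> S - K" for x
    using gradient_eq_0_outside[OF S compact_imp_closed[OF K(1)] K(3) that] .
  have div: "divergence F x = (\<Sum>i\<in>UNIV. F' x (axis i 1) $ i)" if "x \<in> S" for x
    unfolding divergence_def using frechet_derivative_at[OF F'(1)[OF that]] by simp
  define h where "h i x = F' x (axis i 1) $ i * \<phi> x + F x $ i * gradient \<phi> x $ i" for i x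
  have int_h: "set_integrable lebesgue S (h i)" for i
    unfolding h_def
    by (rule set_integrable_continuous_compact_support[OF K(1,2)])
      (auto simp: K(3) grad0 intro!: continuous_intros contK)
  have h0: "(LINT x:S|lebesgue. h i x) = 0" for i
  proof -
    define D where "D x = \<phi> x *\<^sub>R (blinfun_inner_left (axis i 1) o\<^sub>L F' x)
      + (F x $ i) *\<^sub>R blinfun_inner_left (gradient \<phi> x)" for x
    have "(LINT x:S|lebesgue. D x (axis i 1)) = 0"
    proof (rule set_integral_C1_derivative_eq_0[OF S K(1,2)])
      show "\<phi> x * F x $ i = 0" if "x \<in> S - K" for x using K(3)[OF that] by simp
      show "continuous_on S D" unfolding D_def by (intro continuous_intros cont)
      show "((\<lambda>x. \<phi> x * F x $ i) has_derivative D x) (at x)" if "x \<in> S" for x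
        by (rule has_derivative_eq_rhs[OF has_derivative_mult[OF C1_on_gradient(1)[OF \<phi> that]
              bounded_linear.has_derivative[OF bounded_linear_vec_nth F'(1)[OF that]]]])
          (auto simp: D_def fun_eq_iff blinfun.add_left blinfun.scaleR_left inner_axis inner_commute)
    qed
    also have "(\<lambda>x. D x (axis i 1)) = h i"
      by (auto simp: D_def h_def fun_eq_iff blinfun.add_left blinfun.scaleR_left inner_axis inner_axis' mult.commute)
    finally show ?thesis by simp
  qed
  have "(LINT x:S|lebesgue. divergence F x * \<phi> x) + (LINT x:S|lebesgue. F x \<bullet> gradient \<phi> x)
      = (LINT x:S|lebesgue. divergence F x * \<phi> x + F x \<bullet> gradient \<phi> x)"
  proof (rule set_integral_add(2)[symmetric]; rule set_integrable_continuous_compact_support[OF K(1,2)])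
    have "continuous_on K (\<lambda>x. (\<Sum>i\<in>UNIV. F' x (axis i 1) $ i) * \<phi> x)"
      by (intro continuous_intros contK)
    then show "continuous_on K (\<lambda>x. divergence F x * \<phi> x)"
      using div K(2) by (simp add: subset_iff cong: continuous_on_cong)
    show "continuous_on K (\<lambda>x. F x \<bullet> gradient \<phi> x)"
      by (intro continuous_intros contK)
  qed (auto simp: K(3) grad0)
  also have "\<dots> = (LINT x:S|lebesgue. (\<Sum>i\<in>UNIV. h i x))"
    using S by (intro set_lebesgue_integral_cong)
      (auto simp: div h_def inner_vec_def sum.distrib sum_distrib_right)
  also have "\<dots> = (\<Sum>i\<in>UNIV. LINT x:S|lebesgue. h i x)"
    unfolding set_lebesgue_integral_def scaleR_sum_right
    using int_h by (intro Bochner_Integration.integral_sum) (auto simp: set_integrable_def)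
  finally show ?thesis by (simp add: h0)
qed

section \<open>Powers of the norm\<close>

text \<open>At a zero of \<open>f\<close> the factor \<open>|f|\<^bsup>p - 2\<^esup>\<close> may blow up, but the product has norm
  \<open>|f|\<^bsup>p - 1\<^esup>\<close>, which tends to zero.\<close>

lemma continuous_on_norm_powr_scaleR:
  fixes f :: "'a::topological_space \<Rightarrow> 'b::real_normed_vector"
  assumes "p > 1" "continuous_on S f"
  shows "continuous_on S (\<lambda>x. norm (f x) powr (p - 2) *\<^sub>R f x)"
proof -
  have "isCont (\<lambda>a::'b. norm a powr (p - 2) *\<^sub>R a) a" for a
  proof (cases "a = 0")
    case False
    then show ?thesis by (intro continuous_intros) auto
  next
    case True
    have "((\<lambda>a::'b. norm a powr (p - 1)) \<longlongrightarrow> 0 powr (p - 1)) (at 0)"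
      using assms(1) by (intro tendsto_powr' tendsto_norm_zero tendsto_intros) auto
    then have "((\<lambda>a::'b. norm (norm a powr (p - 2) *\<^sub>R a)) \<longlongrightarrow> 0) (at 0)"
      by (simp add: powr_mult_base mult.commute algebra_simps)
    then have "((\<lambda>a::'b. norm a powr (p - 2) *\<^sub>R a) \<longlongrightarrow> 0) (at 0)"
      by (rule tendsto_norm_zero_cancel)
    then show ?thesis using True by (simp add: isCont_def)
  qed
  then have "continuous_on UNIV (\<lambda>a::'b. norm a powr (p - 2) *\<^sub>R a)"
    by (simp add: continuous_at_imp_continuous_on)
  from continuous_on_compose2[OF this assms(2)] show ?thesis by simp
qed

text \<open>The derivative is written with \<open>|t|\<^bsup>p - 2\<^esup> t\<close> so that one formula covers both signs and
  \<open>t = 0\<close>, where the difference quotient of \<open>|t|\<^sup>p\<close> is \<open>|h|\<^bsup>p - 2\<^esup> h\<close>, which tends to zero.\<close>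

lemma has_real_derivative_abs_powr:
  assumes "p > 1"
  shows "((\<lambda>t::real. \<bar>t\<bar> powr p) has_real_derivative p * (\<bar>t\<bar> powr (p - 2) * t)) (at t)"
proof (cases t "0::real" rule: linorder_cases)
  case greater
  have "((\<lambda>t. t powr p) has_real_derivative p * (\<bar>t\<bar> powr (p - 2) * t)) (at t)"
    using has_real_derivative_powr[OF greater, of p] greater powr_mult_base[of t "p - 2"]
    by (simp add: mult.commute)
  then show ?thesis
    by (rule has_field_derivative_transform_within_open[of _ _ _ "{0<..}"]) (use greater in auto)
next
  case less
  have "((\<lambda>t. (- t) powr p) has_real_derivative p * (- t) powr (p - 1) * - 1) (at t)"
    by (rule DERIV_chain2[OF has_real_derivative_powr]) (use less in \<open>auto intro!: derivative_eq_intros\<close>)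
  also have "(- t) powr (p - 1) = - t * (- t) powr (p - 2)"
    using less powr_mult_base[of "- t" "p - 2"] by simp
  also have "p * (- t * (- t) powr (p - 2)) * - 1 = p * (\<bar>t\<bar> powr (p - 2) * t)"
    using less by simp
  finally have "((\<lambda>t. (- t) powr p) has_real_derivative p * (\<bar>t\<bar> powr (p - 2) * t)) (at t)" .
  then show ?thesis
    by (rule has_field_derivative_transform_within_open[of _ _ _ "{..<0}"]) (use less in auto)
next
  case equal
  have "continuous_on UNIV (\<lambda>h::real. norm h powr (p - 2) *\<^sub>R h)"
    by (rule continuous_on_norm_powr_scaleR[OF assms continuous_on_id])
  then have "((\<lambda>h::real. \<bar>h\<bar> powr (p - 2) * h) \<longlongrightarrow> 0) (at 0)"
    by (auto simp: continuous_on_eq_continuous_at isCont_def dest: spec[of _ 0])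
  moreover have "\<bar>h\<bar> powr p / h = \<bar>h\<bar> powr (p - 2) * h" for h :: real
  proof (cases "h = 0")
    case False
    have "\<bar>h\<bar> powr p = \<bar>h\<bar> powr (p - 2) * (\<bar>h\<bar> * \<bar>h\<bar>)"
      using False powr_add[of "\<bar>h\<bar>" "p - 2" 2] by (simp add: powr_numeral power2_eq_square)
    then show ?thesis using False by simp
  qed simp
  ultimately show ?thesis using equal by (simp add: DERIV_def)
qed

lemma C1_on_abs_powr:
  fixes u :: "'a::euclidean_space \<Rightarrow> real"
  assumes p: "p > 1" and u: "C1_on S u"
  shows "C1_on S (\<lambda>x. \<bar>u x\<bar> powr p)"
    and "\<And>x. x \<in> S \<Longrightarrow>
      gradient (\<lambda>x. \<bar>u x\<bar> powr p) x = (p * (\<bar>u x\<bar> powr (p - 2) * u x)) *\<^sub>R gradient u x"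
proof -
  let ?G = "\<lambda>x. (p * (\<bar>u x\<bar> powr (p - 2) * u x)) *\<^sub>R gradient u x"
  have deriv: "((\<lambda>x. \<bar>u x\<bar> powr p) has_derivative (\<lambda>h. h \<bullet> ?G x)) (at x)" if "x \<in> S" for x
    using GDERIV_DERIV_compose[OF _ has_real_derivative_abs_powr[OF p]] C1_on_gradient(1)[OF u that]
    unfolding gderiv_def by blast
  then show "gradient (\<lambda>x. \<bar>u x\<bar> powr p) x = ?G x" if "x \<in> S" for x
    using gradient_eqI that by blast
  have "continuous_on S (\<lambda>x. \<bar>u x\<bar> powr (p - 2) * u x)"
    using continuous_on_norm_powr_scaleR[OF p C1_on_continuous_on[OF u]] by simp
  then have "continuous_on S ?G"
    by (rule continuous_on_scaleR[OF continuous_on_mult[OF continuous_on_const] C1_on_gradient(2)[OF u]])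
  with deriv show "C1_on S (\<lambda>x. \<bar>u x\<bar> powr p)" by (rule C1_onI_gradient)
qed

section \<open>The identities\<close>

text \<open>The two scalings are matched so that they cancel in the mixed term: \<open>c = \<alpha>\<^bsup>-1/(p - 1)\<^esup>\<close>
  satisfies \<open>c\<^bsup>p - 1\<^esup> \<alpha> = 1\<close>.\<close>

lemma R_p_scaled:
  fixes a b :: "'a::euclidean_space"
  assumes "p > 1" "\<alpha> > 0"
  shows "R_p p ((1 / \<alpha> powr (1 / (p - 1))) *\<^sub>R a) (\<alpha> *\<^sub>R b)
    = \<alpha> powr p * norm b powr p + (p - 1) / \<alpha> powr (p / (p - 1)) * norm a powr p
      - p * ((norm a powr (p - 2) *\<^sub>R a) \<bullet> b)"
proof -
  define c where "c = 1 / \<alpha> powr (1 / (p - 1))"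
  have c: "c > 0" using assms by (simp add: c_def)
  have c_powr: "c powr s = 1 / \<alpha> powr (s / (p - 1))" for s
    using assms by (simp add: c_def powr_divide powr_powr)
  have "c powr (p - 2) * c = c powr (p - 1)"
    using c powr_mult_base[of c "p - 2"] by (simp add: mult.commute)
  also have "\<dots> = 1 / \<alpha>" using assms by (simp add: c_powr)
  finally have "c powr (p - 2) * c * \<alpha> = 1" using assms by simp
  then have cross: "((c * norm a) powr (p - 2) *\<^sub>R (c *\<^sub>R a)) \<bullet> (\<alpha> *\<^sub>R b)
      = (norm a powr (p - 2) *\<^sub>R a) \<bullet> b"
    using c by (simp add: powr_mult algebra_simps)
  show ?thesis
    unfolding R_p_def c_def[symmetric]
    using c assms cross c_powr[of p] by (simp add: powr_mult)
qed

theorem theorem1p2: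
  fixes \<Omega> :: "(real ^ 'n) set"
    and p \<alpha> :: real
    and A u :: "real ^ 'n \<Rightarrow> real"
    and X :: "real ^ 'n \<Rightarrow> real ^ 'n"
  assumes "open \<Omega>"
    and "p > 1"
    and "\<alpha> > 0"
    and "C1_on \<Omega> A"
    and "C1_on \<Omega> X"
    and "C1_compact_support \<Omega> u"
  shows
    "(\<alpha> powr p * (LINT x:\<Omega>|lebesgue. A x * norm (gradient u x) powr p)
       + (p - 1) / \<alpha> powr (p / (p - 1))
         * (LINT x:\<Omega>|lebesgue. A x * norm (X x) powr p * \<bar>u x\<bar> powr p)
     = - div_integral \<Omega> (\<lambda>x. A x *\<^sub>R (norm (X x) powr (p - 2) *\<^sub>R X x)) (\<lambda>x. \<bar>u x\<bar> powr p)
       + (LINT x:\<Omega>|lebesgue. A x *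
            R_p p ((1 / \<alpha> powr (1 / (p - 1))) *\<^sub>R (u x *\<^sub>R X x)) (\<alpha> *\<^sub>R gradient u x)))
     \<and>
     (\<alpha> powr p * (LINT x:\<Omega>|lebesgue. A x * \<bar>unit_field X x \<bullet> gradient u x\<bar> powr p)
       + (p - 1) / \<alpha> powr (p / (p - 1))
         * (LINT x:\<Omega>|lebesgue. A x * norm (X x) powr p * \<bar>u x\<bar> powr p)
     = - div_integral \<Omega> (\<lambda>x. A x *\<^sub>R (norm (X x) powr (p - 2) *\<^sub>R X x)) (\<lambda>x. \<bar>u x\<bar> powr p)
       + (LINT x:\<Omega>|lebesgue. A x *
            R_p p ((1 / \<alpha> powr (1 / (p - 1))) * (u x * norm (X x)))
                  (\<alpha> * (unit_field X x \<bullet> gradient u x))))"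
proof -
  note S = assms(1) and p = assms(2) and \<alpha> = assms(3) and A = assms(4) and X = assms(5)
  define K where "K = closure (support_on \<Omega> u)"
  have u: "C1_on \<Omega> u" and K: "compact K" "K \<subseteq> \<Omega>"
    using assms(6) by (auto simp: C1_compact_support_def K_def)
  have u0: "u x = 0" if "x \<in> \<Omega> - K" for x
    using that closure_subset[of "support_on \<Omega> u"] by (auto simp: K_def support_on_def)
  have grad0: "gradient u x = 0" if "x \<in> \<Omega> - K" for x
    using gradient_eq_0_outside[OF S compact_imp_closed[OF K(1)] u0 that] .
  define \<phi> where "\<phi> x = \<bar>u x\<bar> powr p" for x
  define F where "F x = A x *\<^sub>R (norm (X x) powr (p - 2) *\<^sub>R X x)" for x
  have \<phi>: "C1_on \<Omega> \<phi>"
    and grad_\<phi>: "\<And>x. x \<in> \<Omega> \<Longrightarrow> gradient \<phi> x = (p * (\<bar>u x\<bar> powr (p - 2) * u x)) *\<^sub>R gradient u x"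
    unfolding \<phi>_def using C1_on_abs_powr[OF p u] by auto
  have \<phi>0: "\<phi> x = 0" if "x \<in> \<Omega> - K" for x
    using u0[OF that] by (simp add: \<phi>_def)
  \<comment> \<open>If \<open>F\<close> is not \<open>C\<^sup>1\<close> this is the meaning of the distributional divergence.\<close>
  have div: "div_integral \<Omega> F \<phi> = - (LINT x:\<Omega>|lebesgue. F x \<bullet> gradient \<phi> x)"
    using integral_divergence_by_parts[OF S K \<phi>0 _ \<phi>] by (simp add: div_integral_def)
  note contK = C1_on_continuous_on[OF A, THEN continuous_on_subset, OF K(2)]
    C1_on_continuous_on[OF X, THEN continuous_on_subset, OF K(2)]
    C1_on_gradient(2)[OF u, THEN continuous_on_subset, OF K(2)]
    C1_on_continuous_on[OF \<phi>, THEN continuous_on_subset, OF K(2)]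
    C1_on_gradient(2)[OF \<phi>, THEN continuous_on_subset, OF K(2)]
  have norm_powr: "continuous_on K (\<lambda>x. norm (f x) powr p)"
    if "continuous_on K f" for f :: "real ^ 'n \<Rightarrow> real ^ 'n"
    using p that by (intro continuous_on_powr' continuous_intros) auto
  have cont_T: "continuous_on K (\<lambda>x. A x * norm (gradient u x) powr p)"
    by (intro continuous_on_mult norm_powr contK)
  have int_T: "set_integrable lebesgue \<Omega> (\<lambda>x. A x * norm (gradient u x) powr p)"
    by (rule set_integrable_continuous_compact_support[OF K _ cont_T]) (simp add: grad0)
  have int_T': "set_integrable lebesgue \<Omega> (\<lambda>x. A x * \<bar>unit_field X x \<bullet> gradient u x\<bar> powr p)"
  proof (rule set_integrable_bounded_compact_support[OF K])
    have [measurable]: "A \<in> borel_measurable (restrict_space borel K)"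
      "X \<in> borel_measurable (restrict_space borel K)"
      "gradient u \<in> borel_measurable (restrict_space borel K)"
      by (rule borel_measurable_continuous_on_restrict[OF contK(1)]
          borel_measurable_continuous_on_restrict[OF contK(2)]
          borel_measurable_continuous_on_restrict[OF contK(3)])+
    show "(\<lambda>x. A x * \<bar>unit_field X x \<bullet> gradient u x\<bar> powr p) \<in> borel_measurable (restrict_space borel K)"
      unfolding unit_field_def by measurable
    show "continuous_on K (\<lambda>x. \<bar>A x * norm (gradient u x) powr p\<bar>)"
      by (intro continuous_on_rabs cont_T)
    fix x
    have "norm (unit_field X x) \<le> 1" by (cases "X x = 0") (simp_all add: unit_field_def)
    then have "\<bar>unit_field X x \<bullet> gradient u x\<bar> \<le> 1 * norm (gradient u x)"
      by (intro order_trans[OF Cauchy_Schwarz_ineq2] mult_right_mono) auto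
    then have "\<bar>unit_field X x \<bullet> gradient u x\<bar> powr p \<le> norm (gradient u x) powr p"
      using p by (intro powr_mono2) auto
    then show "\<bar>A x * \<bar>unit_field X x \<bullet> gradient u x\<bar> powr p\<bar> \<le> \<bar>A x * norm (gradient u x) powr p\<bar>"
      by (simp add: abs_mult mult_left_mono)
  qed (simp add: grad0)
  have int_V: "set_integrable lebesgue \<Omega> (\<lambda>x. A x * norm (X x) powr p * \<bar>u x\<bar> powr p)"
    unfolding \<phi>_def[symmetric]
    by (rule set_integrable_continuous_compact_support[OF K])
      (auto simp: \<phi>0 intro!: continuous_on_mult norm_powr contK)
  have cont_C: "continuous_on K (\<lambda>x. F x \<bullet> gradient \<phi> x)"
    unfolding F_def
    by (intro continuous_on_inner continuous_on_scaleR continuous_on_norm_powr_scaleR[OF p] contK)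
  have int_C: "set_integrable lebesgue \<Omega> (\<lambda>x. F x \<bullet> gradient \<phi> x)"
    by (rule set_integrable_continuous_compact_support[OF K _ cont_C]) (simp add: grad0 grad_\<phi>)
  \<comment> \<open>Both identities are instances of this splitting. They differ only in \<open>T\<close>, the density of
    the gradient term, and \<open>R\<close>, the density of the remainder.\<close>
  have split: "\<alpha> powr p * (LINT x:\<Omega>|lebesgue. T x)
        + (p - 1) / \<alpha> powr (p / (p - 1)) * (LINT x:\<Omega>|lebesgue. A x * norm (X x) powr p * \<bar>u x\<bar> powr p)
      = - div_integral \<Omega> F \<phi> + (LINT x:\<Omega>|lebesgue. R x)"
    if T: "set_integrable lebesgue \<Omega> T"
      and R: "\<And>x. x \<in> \<Omega> \<Longrightarrow> R x = \<alpha> powr p * T x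
        + (p - 1) / \<alpha> powr (p / (p - 1)) * (A x * norm (X x) powr p * \<bar>u x\<bar> powr p)
        - F x \<bullet> gradient \<phi> x" for T R
  proof -
    have "(LINT x:\<Omega>|lebesgue. R x) = (LINT x:\<Omega>|lebesgue. \<alpha> powr p * T x
        + (p - 1) / \<alpha> powr (p / (p - 1)) * (A x * norm (X x) powr p * \<bar>u x\<bar> powr p)
        - F x \<bullet> gradient \<phi> x)"
      using S R by (intro set_lebesgue_integral_cong) auto
    also have "\<dots> = \<alpha> powr p * (LINT x:\<Omega>|lebesgue. T x)
        + (p - 1) / \<alpha> powr (p / (p - 1)) * (LINT x:\<Omega>|lebesgue. A x * norm (X x) powr p * \<bar>u x\<bar> powr p)
        - (LINT x:\<Omega>|lebesgue. F x \<bullet> gradient \<phi> x)"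
      by (subst set_integral_diff(2) set_integral_add(2) set_integral_mult_right;
          (intro set_integral_add set_integrable_mult_right T int_V int_C)?)+
        (rule refl)
    finally show ?thesis by (simp add: div)
  qed
  have "A x * R_p p ((1 / \<alpha> powr (1 / (p - 1))) *\<^sub>R (u x *\<^sub>R X x)) (\<alpha> *\<^sub>R gradient u x)
      = \<alpha> powr p * (A x * norm (gradient u x) powr p)
        + (p - 1) / \<alpha> powr (p / (p - 1)) * (A x * norm (X x) powr p * \<bar>u x\<bar> powr p)
        - F x \<bullet> gradient \<phi> x" if "x \<in> \<Omega>" for x
    unfolding R_p_scaled[OF p \<alpha>]
    by (simp add: F_def grad_\<phi>[OF that] powr_mult algebra_simps)
  note first = split[OF int_T this]
  have "A x * R_p p ((1 / \<alpha> powr (1 / (p - 1))) * (u x * norm (X x)))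
        (\<alpha> * (unit_field X x \<bullet> gradient u x))
      = \<alpha> powr p * (A x * \<bar>unit_field X x \<bullet> gradient u x\<bar> powr p)
        + (p - 1) / \<alpha> powr (p / (p - 1)) * (A x * norm (X x) powr p * \<bar>u x\<bar> powr p)
        - F x \<bullet> gradient \<phi> x" if "x \<in> \<Omega>" for x
  proof -
    \<comment> \<open>This is true also at zeros of \<open>X\<close>, where both sides are zero; it turns the product of
      scalars into the mixed term of the first identity.\<close>
    have "norm (X x) * (unit_field X x \<bullet> gradient u x) = X x \<bullet> gradient u x"
      by (cases "X x = 0") (simp_all add: unit_field_def)
    then have "F x \<bullet> gradient \<phi> x = A x * (p * (\<bar>u x\<bar> powr (p - 2) * norm (X x) powr (p - 2)
        * (u x * (norm (X x) * (unit_field X x \<bullet> gradient u x)))))"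
      by (simp add: F_def grad_\<phi>[OF that])
    then show ?thesis
      unfolding R_p_scaled[OF p \<alpha>, of "u x * norm (X x)" "unit_field X x \<bullet> gradient u x",
          unfolded real_scaleR_def real_norm_def inner_real_def]
      by (simp add: powr_mult abs_mult algebra_simps)
  qed
  note second = split[OF int_T' this]
  show ?thesis using first second unfolding F_def[abs_def] \<phi>_def[abs_def] by (rule conjI)
qed

end
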